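(* Let $n\ge 1$ and $k\geq 0$ be integers. Every element $t$ of $\mathbf{F}_n(k)$, the free algebra in $\mathsf{Pa}_n$ on the free generators $x_1,\dots,x_k$, is of the form $$t=\bigvee\{p^L_{\mathcal{T}}\in\mathcal{J}(\mathbf{F}_n(k)) : p^L_{\mathcal{T}}\leq t\},$$ equivalently, $$t=\bigvee\max\{p^L_{\mathcal{T}}\in\mathcal{J}(\mathbf{F}_n(k)) : p^L_{\mathcal{T}}\leq t\},$$ where $p^L_{\mathcal{T}}$ ranges over all $\mathcal{T}\subseteq\mathscr{P}(k)$ with $0<|\mathcal{T}|\leq n$ and all $L\subseteq\bigcap\mathcal{T}$.
   Context: A (distributive) p-algebra is a bounded distributive lattice $(A;\wedge,\vee,0,1)$ with a unary operation ${}^*$ satisfying $x\wedge y=0\iff x\leq y^*$. $\overline{\mathbf{B}}_n$ is the p-algebra obtained from the Boolean algebra $\mathbf{B}_n$ with $n$ atoms by adding a new top element $1$, with $0^*=1$, $1^*=0$ and $x^*$ the Boolean complement of $x$ in $\mathbf{B}_n$ for $x\in B_n\setminus\{0\}$. $\mathsf{Pa}_n$ is the variety generated by $\overline{\mathbf{B}}_n$. $\mathscr{P}(k)$ is the power set of $\{1,\dots,k\}$. For $T\in\mathscr{P}(k)$ put $x_T=\bigwedge_{i\in T}x_i\wedge\bigwedge_{i\notin T}x_i^*$, and for nonempty $\mathcal{T}\subseteq\mathscr{P}(k)$ and $L\subseteq\bigcap\mathcal{T}$ put $p^L_{\mathcal{T}}=\bigl(\bigvee_{T\in\mathcal{T}}x_T\bigr)^{**}\wedge\bigwedge_{i\in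 L}x_i$ (elements of $\mathbf{F}_n(k)$; empty meets equal $1$). $\mathcal{J}(\mathbf{A})$ is the set of nonzero join-irreducible elements of $\mathbf{A}$; $\max S$ is the set of maximal elements of $S$; the empty join is $0$. *)

theory Defs
  imports "HOL-Algebra.Lattice"
begin

text \<open>The pseudocomplement of a (distributive) p-algebra is a record field next to the order; the
  lattice operations, finite meets and joins and the bounds are those of \<^theory>\<open>HOL-Algebra.Lattice\<close>.
  In particular the meet and the join of the empty set are the top and the bottom element.\<close>

record 'a palgebra = "'a gorder" +
  pcomp :: "'a \<Rightarrow> 'a"

locale p_algebra = bounded_lattice A for A :: "'a palgebra" (structure) +
  assumes distrib: "\<lbrakk>x \<in> carrier A; y \<in> carrier A; z \<in> carrier A\<rbrakk> \<Longrightarrow>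
      x \<sqinter> (y \<squnion> z) = (x \<sqinter> y) \<squnion> (x \<sqinter> z)"
    and pcomp_closed: "x \<in> carrier A \<Longrightarrow> pcomp A x \<in> carrier A"
    and pcomp_iff: "\<lbrakk>x \<in> carrier A; y \<in> carrier A\<rbrakk> \<Longrightarrow>
      x \<sqinter> y = \<bottom> \<longleftrightarrow> x \<sqsubseteq> pcomp A y"

text \<open>\<open>Bbar n\<close>: the Boolean algebra of subsets of \<open>{1..n}\<close> with a new top element \<open>NewTop\<close>.\<close>

datatype bbar = Elem "nat set" | NewTop

fun bbar_le :: "bbar \<Rightarrow> bbar \<Rightarrow> bool" where
  "bbar_le (Elem S) (Elem T) \<longleftrightarrow> S \<subseteq> T"
| "bbar_le _ NewTop \<longleftrightarrow> True"
| "bbar_le NewTop (Elem _) \<longleftrightarrow> False"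

fun bbar_pcomp :: "nat \<Rightarrow> bbar \<Rightarrow> bbar" where
  "bbar_pcomp n (Elem S) = (if S = {} then NewTop else Elem ({1..n} - S))"
| "bbar_pcomp n NewTop = Elem {}"

definition Bbar :: "nat \<Rightarrow> bbar palgebra" where
  "Bbar n = \<lparr>carrier = insert NewTop (Elem ` Pow {1..n}), eq = (=), le = bbar_le,
     pcomp = bbar_pcomp n\<rparr>"

datatype pterm =
    Var nat
  | Zero
  | One
  | Meet pterm pterm
  | Join pterm pterm
  | Star pterm

primrec peval :: "'a palgebra \<Rightarrow> (nat \<Rightarrow> 'a) \<Rightarrow> pterm \<Rightarrow> 'a" where
  "peval A v (Var i) = v i"
| "peval A v Zero = \<bottom>\<^bsub>A\<^esub>"
| "peval A v One = \<top>\<^bsub>A\<^esub>"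
| "peval A v (Meet s t) = peval A v s \<sqinter>\<^bsub>A\<^esub> peval A v t"
| "peval A v (Join s t) = peval A v s \<squnion>\<^bsub>A\<^esub> peval A v t"
| "peval A v (Star s) = pcomp A (peval A v s)"

definition satisfies :: "'a palgebra \<Rightarrow> pterm \<times> pterm \<Rightarrow> bool" where
  "satisfies A e \<longleftrightarrow> (\<forall>v. range v \<subseteq> carrier A \<longrightarrow> peval A v (fst e) = peval A v (snd e))"

definition in_equational_class :: "(pterm \<times> pterm) set \<Rightarrow> 'a palgebra \<Rightarrow> bool" where
  "in_equational_class E A \<longleftrightarrow> p_algebra A \<and> (\<forall>e\<in>E. satisfies A e)"

text \<open>The variety generated by \<open>Bbar n\<close>: a variety is an equational class, and the generated
  variety is the least one containing \<open>Bbar n\<close>.\<close>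

definition in_Pa :: "nat \<Rightarrow> 'a palgebra \<Rightarrow> bool" where
  "in_Pa n A \<longleftrightarrow> (\<forall>E. in_equational_class E (Bbar n) \<longrightarrow> in_equational_class E A)"

definition p_hom :: "'a palgebra \<Rightarrow> 'b palgebra \<Rightarrow> ('a \<Rightarrow> 'b) set" where
  "p_hom A B = {h \<in> carrier A \<rightarrow> carrier B. join_pres A B h \<and> meet_pres A B h \<and>
     h \<bottom>\<^bsub>A\<^esub> = \<bottom>\<^bsub>B\<^esub> \<and> h \<top>\<^bsub>A\<^esub> = \<top>\<^bsub>B\<^esub> \<and> (\<forall>a\<in>carrier A. h (pcomp A a) = pcomp B (h a))}"

inductive_set p_generate :: "'a palgebra \<Rightarrow> 'a set \<Rightarrow> 'a set" for A X where
  incl: "a \<in> X \<Longrightarrow> a \<in> p_generate A X"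
| bot: "\<bottom>\<^bsub>A\<^esub> \<in> p_generate A X"
| top: "\<top>\<^bsub>A\<^esub> \<in> p_generate A X"
| meet: "\<lbrakk>a \<in> p_generate A X; b \<in> p_generate A X\<rbrakk> \<Longrightarrow> a \<sqinter>\<^bsub>A\<^esub> b \<in> p_generate A X"
| join: "\<lbrakk>a \<in> p_generate A X; b \<in> p_generate A X\<rbrakk> \<Longrightarrow> a \<squnion>\<^bsub>A\<^esub> b \<in> p_generate A X"
| pcomp: "a \<in> p_generate A X \<Longrightarrow> pcomp A a \<in> p_generate A X"

text \<open>\<open>F\<close> is free in the variety on the free generators \<open>x 1, \<dots>, x k\<close>. Test algebras with carrier
  inside \<open>nat\<close> suffice: a map of the generators into an arbitrary algebra of the variety has its
  image in the finitely generated, hence countable, subalgebra generated by that image, and this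
  subalgebra again lies in the variety. Uniqueness of the extension follows from generation.\<close>

definition free_in_Pa :: "nat \<Rightarrow> nat \<Rightarrow> 'a palgebra \<Rightarrow> (nat \<Rightarrow> 'a) \<Rightarrow> bool" where
  "free_in_Pa n k F x \<longleftrightarrow>
     in_Pa n F \<and> x ` {1..k} \<subseteq> carrier F \<and> carrier F = p_generate F (x ` {1..k}) \<and>
     (\<forall>(B :: nat palgebra) b. in_Pa n B \<and> b ` {1..k} \<subseteq> carrier B \<longrightarrow>
        (\<exists>h \<in> p_hom F B. \<forall>i\<in>{1..k}. h (x i) = b i))"

definition x_elem :: "'a palgebra \<Rightarrow> nat \<Rightarrow> (nat \<Rightarrow> 'a) \<Rightarrow> nat set \<Rightarrow> 'a" where
  "x_elem A k x T =
     \<Sqinter>\<^bsub>A\<^esub>(x ` T) \<sqinter>\<^bsub>A\<^esub> \<Sqinter>\<^bsub>A\<^esub>((\<lambda>i. pcomp A (x i)) ` ({1..k} - T))"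

definition p_elem ::
  "'a palgebra \<Rightarrow> nat \<Rightarrow> (nat \<Rightarrow> 'a) \<Rightarrow> nat set set \<Rightarrow> nat set \<Rightarrow> 'a" where
  "p_elem A k x \<T> L =
     pcomp A (pcomp A (\<Squnion>\<^bsub>A\<^esub>(x_elem A k x ` \<T>))) \<sqinter>\<^bsub>A\<^esub> \<Sqinter>\<^bsub>A\<^esub>(x ` L)"

definition join_irreducibles :: "'a palgebra \<Rightarrow> 'a set" where
  "join_irreducibles A = {j \<in> carrier A. j \<noteq> \<bottom>\<^bsub>A\<^esub> \<and>
     (\<forall>a\<in>carrier A. \<forall>b\<in>carrier A. j = a \<squnion>\<^bsub>A\<^esub> b \<longrightarrow> j = a \<or> j = b)}"

definition max_elems :: "'a palgebra \<Rightarrow> 'a set \<Rightarrow> 'a set" where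
  "max_elems A S = {a \<in> S. \<forall>b\<in>S. a \<sqsubseteq>\<^bsub>A\<^esub> b \<longrightarrow> b = a}"

definition irred_p_elems_below ::
  "nat \<Rightarrow> nat \<Rightarrow> 'a palgebra \<Rightarrow> (nat \<Rightarrow> 'a) \<Rightarrow> 'a \<Rightarrow> 'a set" where
  "irred_p_elems_below n k F x t = {p_elem F k x \<T> L | \<T> L.
     \<T> \<subseteq> Pow {1..k} \<and> 0 < card \<T> \<and> card \<T> \<le> n \<and> L \<subseteq> \<Inter>\<T> \<and>
     p_elem F k x \<T> L \<in> join_irreducibles F \<and> p_elem F k x \<T> L \<sqsubseteq>\<^bsub>F\<^esub> t}"

end

theory Submission
  imports Defs
begin

text \<open>
  Elements of the free algebra \<open>F\<close> are distinguished by homomorphisms \<open>h\<close> into \<open>Bbar n\<close>: an equality that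
  all of them respect is an identity of \<open>Bbar n\<close>, because every assignment of values in \<open>Bbar n\<close> to
  the generators extends to some \<open>h\<close>, and so it holds in \<open>F\<close>. Even the order is determined by the single
  question which \<open>h\<close> send an element to the new top (\<open>le_iff_homs\<close>): each atom \<open>j\<close> of the Boolean
  algebra gives an endomorphism \<open>collapse j\<close> of \<open>Bbar n\<close> which sends the elements above \<open>j\<close> to the
  new top and all others to the bottom, and composing with it recovers the remaining information in \<open>h\<close>.

  Call \<open>L\<close> (below: \<open>truth h\<close>) the set of indices \<open>i\<close> for which \<open>h\<close> sends \<open>x i\<close> to the new top,
  and \<open>\<T>\<close> (below: \<open>points h\<close>) the collection of the analogous sets for the \<open>n\<close> homomorphisms
  \<open>collapse j \<circ> h\<close>. Then \<open>0 < |\<T>| \<le> n\<close> and \<open>L \<subseteq> \<Inter>\<T>\<close>. The pair \<open>(\<T>, L)\<close> behaves like a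
  world of a Kripke model. First, truth is persistent (\<open>NewTop_persistent\<close>): an element that \<open>h\<close>
  sends to the new top is sent there by every \<open>h'\<close> with a smaller \<open>\<T>\<close> and a larger \<open>L\<close>. Secondly,
  the homomorphisms with smaller \<open>\<T>\<close> and larger \<open>L\<close> are exactly those that send \<open>p\<^sup>L\<^sub>\<T>\<close> to
  the new top (\<open>hom_p_elem\<close>). Together, \<open>p\<^sup>L\<^sub>\<T> \<le> t\<close> holds if and only if \<open>h t\<close> is the new top
  (\<open>world_elem_le_iff\<close>).

  Both parts of the claim follow. Since the new top is not a join of two smaller elements, \<open>p\<^sup>L\<^sub>\<T>\<close>
  lies below a join only if it lies below one of the two elements, so it is join-irreducible. And if
  \<open>h t\<close> is the new top, then \<open>p\<^sup>L\<^sub>\<T>\<close> is one of the elements of the join, so \<open>h\<close> sends the join to the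
  new top as well; as this holds for all \<open>h\<close>, the join lies above \<open>t\<close>. Every element of a finite set lies
  below a maximal one (\<open>ex_max_elem_above\<close>), so the maximal elements have the same join.
\<close>

section \<open>Constructing p-algebras from explicit operations\<close>

text \<open>The lattice operations of a record are chosen by Hilbert's operator from its order. To compute with
them in a concrete algebra, this locale takes explicit candidates \<open>j\<close>, \<open>m\<close>, \<open>bt\<close>, \<open>tp\<close> for join, meet,
bottom and top, and identifies them with the chosen ones.\<close>

locale p_algebra_operations =
  fixes A :: "'a palgebra" (structure)
    and j m :: "'a \<Rightarrow> 'a \<Rightarrow> 'a" and bt tp :: 'a
  assumes eq_is_equality: "eq A = (=)"
    and refl: "a \<in> carrier A \<Longrightarrow> a \<sqsubseteq> a"
    and antisym: "\<lbrakk>a \<in> carrier A; b \<in> carrier A; a \<sqsubseteq> b; b \<sqsubseteq> a\<rbrakk> \<Longrightarrow> a = b"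
    and trans: "\<lbrakk>a \<in> carrier A; b \<in> carrier A; c \<in> carrier A; a \<sqsubseteq> b; b \<sqsubseteq> c\<rbrakk> \<Longrightarrow> a \<sqsubseteq> c"
    and j_closed: "\<lbrakk>a \<in> carrier A; b \<in> carrier A\<rbrakk> \<Longrightarrow> j a b \<in> carrier A"
    and j_le_iff: "\<lbrakk>a \<in> carrier A; b \<in> carrier A; c \<in> carrier A\<rbrakk> \<Longrightarrow>
      j a b \<sqsubseteq> c \<longleftrightarrow> a \<sqsubseteq> c \<and> b \<sqsubseteq> c"
    and m_closed: "\<lbrakk>a \<in> carrier A; b \<in> carrier A\<rbrakk> \<Longrightarrow> m a b \<in> carrier A"
    and le_m_iff: "\<lbrakk>a \<in> carrier A; b \<in> carrier A; c \<in> carrier A\<rbrakk> \<Longrightarrow>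
      c \<sqsubseteq> m a b \<longleftrightarrow> c \<sqsubseteq> a \<and> c \<sqsubseteq> b"
    and bt_closed: "bt \<in> carrier A" and bt_le: "a \<in> carrier A \<Longrightarrow> bt \<sqsubseteq> a"
    and tp_closed: "tp \<in> carrier A" and le_tp: "a \<in> carrier A \<Longrightarrow> a \<sqsubseteq> tp"
    and distributive: "\<lbrakk>a \<in> carrier A; b \<in> carrier A; c \<in> carrier A\<rbrakk> \<Longrightarrow>
      m a (j b c) = j (m a b) (m a c)"
    and pc_closed: "a \<in> carrier A \<Longrightarrow> pcomp A a \<in> carrier A"
    and pc_iff: "\<lbrakk>a \<in> carrier A; b \<in> carrier A\<rbrakk> \<Longrightarrow> m a b = bt \<longleftrightarrow> a \<sqsubseteq> pcomp A b"
begin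

lemma j_is_lub:
  assumes "a \<in> carrier A" "b \<in> carrier A"
  shows "is_lub A (j a b) {a, b}"
  using assms j_le_iff[OF assms] j_closed[OF assms] refl[OF j_closed[OF assms]]
  by (auto simp: least_def Upper_def)

lemma m_is_glb:
  assumes "a \<in> carrier A" "b \<in> carrier A"
  shows "is_glb A (m a b) {a, b}"
  using assms le_m_iff[OF assms] m_closed[OF assms] refl[OF m_closed[OF assms]]
  by (auto simp: greatest_def Lower_def)

lemma bt_least: "least A bt (carrier A)"
  using bt_closed bt_le by (auto simp: least_def)

lemma tp_greatest: "greatest A tp (carrier A)"
  using tp_closed le_tp by (auto simp: greatest_def)

lemma bounded: "bounded_lattice A"
proof unfold_locales
  show "\<And>a b c. \<lbrakk>a \<sqsubseteq> b; b \<sqsubseteq> c; a \<in> carrier A; b \<in> carrier A; c \<in> carrier A\<rbrakk> \<Longrightarrow> a \<sqsubseteq> c"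
    using trans by blast
  show "\<And>a b. \<lbrakk>a \<in> carrier A; b \<in> carrier A\<rbrakk> \<Longrightarrow> \<exists>s. is_lub A s {a, b}"
    using j_is_lub by blast
  show "\<And>a b. \<lbrakk>a \<in> carrier A; b \<in> carrier A\<rbrakk> \<Longrightarrow> \<exists>s. is_glb A s {a, b}"
    using m_is_glb by blast
  show "\<exists>a. least A a (carrier A)" "\<exists>a. greatest A a (carrier A)"
    using bt_least tp_greatest by blast+
qed (simp_all add: eq_is_equality refl antisym)

lemma operations:
  assumes "a \<in> carrier A" "b \<in> carrier A"
  shows join_eq: "a \<squnion> b = j a b" and meet_eq: "a \<sqinter> b = m a b"
proof -
  interpret bounded_lattice A by (rule bounded)
  show "a \<squnion> b = j a b"
    using least_unique[OF sup_of_two_least[OF assms] j_is_lub[OF assms]] by (simp add: join_def)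
  show "a \<sqinter> b = m a b"
    using greatest_unique[OF inf_of_two_greatest[OF assms] m_is_glb[OF assms]]
    by (simp add: meet_def)
qed

lemma bounds:
  shows bottom_eq: "\<bottom> = bt" and top_eq: "\<top> = tp"
proof -
  interpret bounded_lattice A by (rule bounded)
  show "\<bottom> = bt" using least_unique[OF bottom_least bt_least] .
  show "\<top> = tp" using greatest_unique[OF top_greatest tp_greatest] .
qed

lemma is_p_algebra: "p_algebra A"
proof -
  interpret bounded_lattice A by (rule bounded)
  show ?thesis
    by unfold_locales
      (simp_all add: operations bounds j_closed m_closed distributive pc_closed pc_iff)
qed

end


section \<open>Homomorphisms and terms\<close>

lemma p_homI:
  assumes "p_algebra A" "p_algebra B" "\<And>a. a \<in> carrier A \<Longrightarrow> h a \<in> carrier B"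
    and "\<And>a b. \<lbrakk>a \<in> carrier A; b \<in> carrier A\<rbrakk> \<Longrightarrow> h (a \<squnion>\<^bsub>A\<^esub> b) = h a \<squnion>\<^bsub>B\<^esub> h b"
    and "\<And>a b. \<lbrakk>a \<in> carrier A; b \<in> carrier A\<rbrakk> \<Longrightarrow> h (a \<sqinter>\<^bsub>A\<^esub> b) = h a \<sqinter>\<^bsub>B\<^esub> h b"
    and "h \<bottom>\<^bsub>A\<^esub> = \<bottom>\<^bsub>B\<^esub>" "h \<top>\<^bsub>A\<^esub> = \<top>\<^bsub>B\<^esub>"
    and "\<And>a. a \<in> carrier A \<Longrightarrow> h (pcomp A a) = pcomp B (h a)"
  shows "h \<in> p_hom A B"
  using assms
  by (auto simp: p_hom_def join_pres_def meet_pres_def p_algebra_def bounded_lattice_def)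

lemma p_homD:
  assumes "h \<in> p_hom A B"
  shows p_hom_closed: "a \<in> carrier A \<Longrightarrow> h a \<in> carrier B"
    and p_hom_join: "\<lbrakk>a \<in> carrier A; b \<in> carrier A\<rbrakk> \<Longrightarrow> h (a \<squnion>\<^bsub>A\<^esub> b) = h a \<squnion>\<^bsub>B\<^esub> h b"
    and p_hom_meet: "\<lbrakk>a \<in> carrier A; b \<in> carrier A\<rbrakk> \<Longrightarrow> h (a \<sqinter>\<^bsub>A\<^esub> b) = h a \<sqinter>\<^bsub>B\<^esub> h b"
    and p_hom_bottom: "h \<bottom>\<^bsub>A\<^esub> = \<bottom>\<^bsub>B\<^esub>" and p_hom_top: "h \<top>\<^bsub>A\<^esub> = \<top>\<^bsub>B\<^esub>"
    and p_hom_pcomp: "a \<in> carrier A \<Longrightarrow> h (pcomp A a) = pcomp B (h a)"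
  using assms by (auto simp: p_hom_def join_pres_def meet_pres_def)

lemma p_hom_comp:
  assumes "p_algebra A" "p_algebra C" "h \<in> p_hom A B" "g \<in> p_hom B C"
  shows "g \<circ> h \<in> p_hom A C"
  using assms by (intro p_homI) (simp_all add: p_homD)

lemma peval_closed:
  assumes "p_algebra A" "range v \<subseteq> carrier A"
  shows "peval A v s \<in> carrier A"
proof -
  interpret p_algebra A by fact
  show ?thesis by (induction s) (use assms(2) pcomp_closed in auto)
qed

lemma p_hom_peval:
  assumes "p_algebra A" "h \<in> p_hom A B" "range v \<subseteq> carrier A"
  shows "h (peval A v s) = peval B (h \<circ> v) s"
  by (induction s) (simp_all add: p_homD[OF assms(2)] peval_closed[OF assms(1,3)])

text \<open>Identities pass to subalgebras, here up to isomorphism: an injective homomorphism transfers the two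
values of an identity to \<open>B\<close>, where they agree.\<close>

lemma satisfies_if_injective_p_hom:
  assumes "p_algebra A" "h \<in> p_hom A B" "inj_on h (carrier A)" "satisfies B e"
  shows "satisfies A e"
  unfolding satisfies_def
proof (intro allI impI)
  fix v :: "nat \<Rightarrow> 'a" assume v: "range v \<subseteq> carrier A"
  have "range (h \<circ> v) \<subseteq> carrier B" using v p_hom_closed[OF assms(2)] by auto
  then have "h (peval A v (fst e)) = h (peval A v (snd e))"
    using assms(4) by (simp add: satisfies_def p_hom_peval[OF assms(1,2) v])
  then show "peval A v (fst e) = peval A v (snd e)"
    using assms(3) peval_closed[OF assms(1) v] by (auto dest: inj_onD)
qed

primrec pvars :: "pterm \<Rightarrow> nat set" where
  "pvars (Var i) = {i}"
| "pvars Zero = {}"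
| "pvars One = {}"
| "pvars (Meet s t) = pvars s \<union> pvars t"
| "pvars (Join s t) = pvars s \<union> pvars t"
| "pvars (Star s) = pvars s"

lemma peval_cong: "(\<And>i. i \<in> pvars s \<Longrightarrow> v i = w i) \<Longrightarrow> peval A v s = peval A w s"
  by (induction s) auto

lemma generated_by_term:
  assumes "a \<in> p_generate A (v ` I)"
  shows "\<exists>s. pvars s \<subseteq> I \<and> a = peval A v s"
  using assms
proof induction
  case (incl a)
  then obtain i where "i \<in> I" "a = v i" by auto
  then show ?case by (intro exI[of _ "Var i"]) auto
next
  case bot show ?case by (intro exI[of _ Zero]) auto
next
  case top show ?case by (intro exI[of _ One]) auto
next
  case (meet a b)
  then obtain s t where "pvars s \<subseteq> I \<and> a = peval A v s" "pvars t \<subseteq> I \<and> b = peval A v t" by auto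
  then show ?case by (intro exI[of _ "Meet s t"]) auto
next
  case (join a b)
  then obtain s t where "pvars s \<subseteq> I \<and> a = peval A v s" "pvars t \<subseteq> I \<and> b = peval A v t" by auto
  then show ?case by (intro exI[of _ "Join s t"]) auto
next
  case (pcomp a)
  then obtain s where "pvars s \<subseteq> I \<and> a = peval A v s" by auto
  then show ?case by (intro exI[of _ "Star s"]) auto
qed

text \<open>Freeness is tested on algebras with carrier in \<^typ>\<open>nat\<close>. Transporting the structure of the finite
algebra \<open>Bbar n\<close> along an injection \<open>f\<close> makes it available as such a test algebra.\<close>

definition copy :: "('a \<Rightarrow> 'b) \<Rightarrow> 'a palgebra \<Rightarrow> 'b palgebra" where
  "copy f A = (let g = inv_into (carrier A) f in
     \<lparr>carrier = f ` carrier A, eq = (=), le = (\<lambda>a b. g a \<sqsubseteq>\<^bsub>A\<^esub> g b),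
      pcomp = (\<lambda>a. f (pcomp A (g a)))\<rparr>)"

lemma copy_is_isomorphic:
  fixes A :: "'a palgebra" (structure)
  assumes "p_algebra A" and inj: "inj_on f (carrier A)"
  shows "p_algebra (copy f A)" and "inv_into (carrier A) f \<in> p_hom (copy f A) A"
proof -
  interpret p_algebra A by fact
  define g where "g = inv_into (carrier A) f"
  have gf: "g (f a) = a" if "a \<in> carrier A" for a using that inj by (simp add: g_def)
  have copy: "carrier (copy f A) = f ` carrier A" "eq (copy f A) = (=)"
    "a \<sqsubseteq>\<^bsub>copy f A\<^esub> b \<longleftrightarrow> g a \<sqsubseteq> g b" "pcomp (copy f A) a = f (pcomp A (g a))" for a b
    by (simp_all add: copy_def Let_def g_def)
  interpret ops: p_algebra_operations "copy f A" "\<lambda>a b. f (g a \<squnion> g b)" "\<lambda>a b. f (g a \<sqinter> g b)"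
    "f \<bottom>" "f \<top>"
  proof unfold_locales
    show "eq (copy f A) = (=)" by (rule copy)
    have le_join_iff: "a \<squnion> b \<sqsubseteq> c \<longleftrightarrow> a \<sqsubseteq> c \<and> b \<sqsubseteq> c"
      if "a \<in> carrier A" "b \<in> carrier A" "c \<in> carrier A" for a b c
      using that by (meson join_closed join_le join_left join_right le_trans)
    have le_meet_iff: "c \<sqsubseteq> a \<sqinter> b \<longleftrightarrow> c \<sqsubseteq> a \<and> c \<sqsubseteq> b"
      if "a \<in> carrier A" "b \<in> carrier A" "c \<in> carrier A" for a b c
      using that by (meson meet_closed meet_le meet_left meet_right le_trans)
    fix a b c
    assume a: "a \<in> carrier (copy f A)"
    then show "a \<sqsubseteq>\<^bsub>copy f A\<^esub> a" "f \<bottom> \<sqsubseteq>\<^bsub>copy f A\<^esub> a" "a \<sqsubseteq>\<^bsub>copy f A\<^esub> f \<top>"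
      "pcomp (copy f A) a \<in> carrier (copy f A)"
      by (auto simp: copy gf pcomp_closed)
    assume b: "b \<in> carrier (copy f A)"
    with a show "f (g a \<squnion> g b) \<in> carrier (copy f A)" "f (g a \<sqinter> g b) \<in> carrier (copy f A)"
      by (auto simp: copy gf)
    show "a \<sqsubseteq>\<^bsub>copy f A\<^esub> b \<Longrightarrow> b \<sqsubseteq>\<^bsub>copy f A\<^esub> a \<Longrightarrow> a = b"
      using a b by (auto simp: copy gf intro: arg_cong[of _ _ f, OF le_antisym])
    have "f y = f z \<longleftrightarrow> y = z" if "y \<in> carrier A" "z \<in> carrier A" for y z
      using that inj by (auto dest: inj_onD)
    with a b show "(f (g a \<sqinter> g b) = f \<bottom>) = (a \<sqsubseteq>\<^bsub>copy f A\<^esub> pcomp (copy f A) b)"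
      by (auto simp: copy gf pcomp_iff pcomp_closed)
    assume c: "c \<in> carrier (copy f A)"
    show "a \<sqsubseteq>\<^bsub>copy f A\<^esub> b \<Longrightarrow> b \<sqsubseteq>\<^bsub>copy f A\<^esub> c \<Longrightarrow> a \<sqsubseteq>\<^bsub>copy f A\<^esub> c"
      using a b c by (auto simp: copy gf intro: le_trans)
    show "f (g a \<squnion> g b) \<sqsubseteq>\<^bsub>copy f A\<^esub> c \<longleftrightarrow> a \<sqsubseteq>\<^bsub>copy f A\<^esub> c \<and> b \<sqsubseteq>\<^bsub>copy f A\<^esub> c"
      "c \<sqsubseteq>\<^bsub>copy f A\<^esub> f (g a \<sqinter> g b) \<longleftrightarrow> c \<sqsubseteq>\<^bsub>copy f A\<^esub> a \<and> c \<sqsubseteq>\<^bsub>copy f A\<^esub> b"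
      using a b c by (auto simp: copy gf le_join_iff le_meet_iff)
    show "f (g a \<sqinter> g (f (g b \<squnion> g c))) = f (g (f (g a \<sqinter> g b)) \<squnion> g (f (g a \<sqinter> g c)))"
      using a b c by (auto simp: copy gf distrib)
  qed (auto simp: copy)
  show p: "p_algebra (copy f A)" by (rule ops.is_p_algebra)
  have "g \<in> p_hom (copy f A) A"
    by (rule p_homI[OF p \<open>p_algebra A\<close>])
      (auto simp: ops.operations ops.bounds copy gf pcomp_closed)
  then show "inv_into (carrier A) f \<in> p_hom (copy f A) A" by (simp add: g_def)
qed


section \<open>Finite joins and meets\<close>

context p_algebra
begin

lemma is_lub_sup:
  assumes "finite X" "X \<subseteq> carrier A"
  shows "is_lub A (\<Squnion>X) X"
proof (cases "X = {}")
  case True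
  then show ?thesis using bottom_least by (simp add: bottom_def Lattice.sup_def)
next
  case False
  then show ?thesis by (rule finite_sup_least[OF assms])
qed

lemma is_glb_inf:
  assumes "finite X" "X \<subseteq> carrier A"
  shows "is_glb A (\<Sqinter>X) X"
proof (cases "X = {}")
  case True
  then show ?thesis using top_greatest by (simp add: top_def Lattice.inf_def)
next
  case False
  then show ?thesis by (rule finite_inf_greatest[OF assms])
qed

lemma fin_sup_closed: "\<lbrakk>finite X; X \<subseteq> carrier A\<rbrakk> \<Longrightarrow> \<Squnion>X \<in> carrier A"
  by (rule least_closed[OF is_lub_sup])

lemma fin_inf_closed: "\<lbrakk>finite X; X \<subseteq> carrier A\<rbrakk> \<Longrightarrow> \<Sqinter>X \<in> carrier A"
  by (rule greatest_closed[OF is_glb_inf])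

lemma fin_sup_upper: "\<lbrakk>finite X; X \<subseteq> carrier A; a \<in> X\<rbrakk> \<Longrightarrow> a \<sqsubseteq> \<Squnion>X"
  by (rule least_Upper_above[OF is_lub_sup])

lemma fin_sup_le: "\<lbrakk>finite X; X \<subseteq> carrier A; c \<in> carrier A; \<And>a. a \<in> X \<Longrightarrow> a \<sqsubseteq> c\<rbrakk> \<Longrightarrow> \<Squnion>X \<sqsubseteq> c"
  by (rule least_le[OF is_lub_sup], assumption, assumption, rule Upper_memI)

lemma fin_inf_lower: "\<lbrakk>finite X; X \<subseteq> carrier A; a \<in> X\<rbrakk> \<Longrightarrow> \<Sqinter>X \<sqsubseteq> a"
  by (rule greatest_Lower_below[OF is_glb_inf])

lemma fin_inf_ge: "\<lbrakk>finite X; X \<subseteq> carrier A; c \<in> carrier A; \<And>a. a \<in> X \<Longrightarrow> c \<sqsubseteq> a\<rbrakk> \<Longrightarrow> c \<sqsubseteq> \<Sqinter>X"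
  by (rule greatest_le[OF is_glb_inf], assumption, assumption, rule Lower_memI)

lemma sup_insert_join:
  assumes X: "finite X" "X \<subseteq> carrier A" and a: "a \<in> carrier A"
  shows "\<Squnion>(insert a X) = a \<squnion> \<Squnion>X"
proof (rule le_antisym)
  have I: "finite (insert a X)" "insert a X \<subseteq> carrier A" using X a by auto
  note S = fin_sup_closed[OF X]
  show "\<Squnion>(insert a X) \<in> carrier A" by (rule fin_sup_closed[OF I])
  show J: "a \<squnion> \<Squnion>X \<in> carrier A" by (rule join_closed[OF a S])
  have "b \<sqsubseteq> a \<squnion> \<Squnion>X" if "b \<in> X" for b
    using that X J S by (meson fin_sup_upper join_right[OF a S] le_trans subsetD)
  then show "\<Squnion>(insert a X) \<sqsubseteq> a \<squnion> \<Squnion>X"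
    using join_left[OF a S] by (intro fin_sup_le[OF I J]) blast
  show "a \<squnion> \<Squnion>X \<sqsubseteq> \<Squnion>(insert a X)"
    by (intro join_le[OF _ _ a S] fin_sup_le[OF X] fin_sup_upper[OF I] fin_sup_closed[OF I]) simp_all
qed

lemma inf_insert_meet:
  assumes X: "finite X" "X \<subseteq> carrier A" and a: "a \<in> carrier A"
  shows "\<Sqinter>(insert a X) = a \<sqinter> \<Sqinter>X"
proof (rule le_antisym)
  have I: "finite (insert a X)" "insert a X \<subseteq> carrier A" using X a by auto
  note S = fin_inf_closed[OF X]
  show "\<Sqinter>(insert a X) \<in> carrier A" by (rule fin_inf_closed[OF I])
  show M: "a \<sqinter> \<Sqinter>X \<in> carrier A" by (rule meet_closed[OF a S])
  have "a \<sqinter> \<Sqinter>X \<sqsubseteq> b" if "b \<in> X" for b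
    using that X M S by (meson fin_inf_lower meet_right[OF a S] le_trans subsetD)
  then show "a \<sqinter> \<Sqinter>X \<sqsubseteq> \<Sqinter>(insert a X)"
    using meet_left[OF a S] by (intro fin_inf_ge[OF I M]) blast
  show "\<Sqinter>(insert a X) \<sqsubseteq> a \<sqinter> \<Sqinter>X"
    by (intro meet_le[OF _ _ a S] fin_inf_ge[OF X] fin_inf_lower[OF I] fin_inf_closed[OF I]) simp_all
qed

lemma sup_empty_bottom: "\<Squnion>{} = \<bottom>" and inf_empty_top: "\<Sqinter>{} = \<top>"
  by (simp_all add: bottom_def top_def Lattice.sup_def Lattice.inf_def)

text \<open>Passing from an element that is not maximal to a strictly larger one shrinks the finite set of
elements of \<open>X\<close> above it, so this process stops.\<close>

lemma ex_max_elem_above: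
  assumes X: "finite X" "X \<subseteq> carrier A" and a: "a \<in> X"
  shows "\<exists>b \<in> max_elems A X. a \<sqsubseteq> b"
  using a
proof (induction "card {d \<in> X. a \<sqsubseteq> d}" arbitrary: a rule: less_induct)
  case less
  have closed: "d \<in> carrier A" if "d \<in> X" for d using that X(2) by (rule subsetD[rotated])
  show ?case
  proof (cases "a \<in> max_elems A X")
    case True
    then show ?thesis by (rule bexI[rotated]) (rule le_refl[OF closed[OF less.prems]])
  next
    case False
    then obtain b where b: "b \<in> X" "a \<sqsubseteq> b" "b \<noteq> a"
      unfolding max_elems_def using less.prems by blast
    have above: "a \<sqsubseteq> d" if "d \<in> X" "b \<sqsubseteq> d" for d
      by (rule le_trans[OF b(2) that(2)]) (simp_all only: closed less.prems b(1) that(1))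
    have "\<not> b \<sqsubseteq> a"
      using le_antisym[OF b(2) _ closed[OF less.prems] closed[OF b(1)]] b(3) by metis
    then have "{d \<in> X. b \<sqsubseteq> d} \<subset> {d \<in> X. a \<sqsubseteq> d}"
      using above less.prems le_refl[OF closed[OF less.prems]] by blast
    then have "card {d \<in> X. b \<sqsubseteq> d} < card {d \<in> X. a \<sqsubseteq> d}"
      by (rule psubset_card_mono[rotated]) (simp add: X(1))
    then obtain c where c: "c \<in> max_elems A X" "b \<sqsubseteq> c" using less.hyps b(1) by blast
    then show ?thesis using above[of c] by (auto simp: max_elems_def)
  qed
qed

lemma sup_max_elems:
  assumes X: "finite X" "X \<subseteq> carrier A"
  shows "\<Squnion>(max_elems A X) = \<Squnion>X"
proof (rule le_antisym)
  have sub: "max_elems A X \<subseteq> X" by (auto simp: max_elems_def)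
  have M: "finite (max_elems A X)" "max_elems A X \<subseteq> carrier A"
    using X sub by (auto intro: finite_subset)
  show closed: "\<Squnion>(max_elems A X) \<in> carrier A" "\<Squnion>X \<in> carrier A"
    by (rule fin_sup_closed[OF M] fin_sup_closed[OF X])+
  show "\<Squnion>(max_elems A X) \<sqsubseteq> \<Squnion>X"
    by (rule fin_sup_le[OF M closed(2)], rule fin_sup_upper[OF X]) (use sub in blast)
  show "\<Squnion>X \<sqsubseteq> \<Squnion>(max_elems A X)"
  proof (rule fin_sup_le[OF X closed(1)])
    fix a assume "a \<in> X"
    then obtain b where "b \<in> max_elems A X" "a \<sqsubseteq> b" using ex_max_elem_above[OF X] by blast
    then show "a \<sqsubseteq> \<Squnion>(max_elems A X)"
      using le_trans[OF _ fin_sup_upper[OF M], of a b] \<open>a \<in> X\<close> X(2) M(2) closed(1)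
      by (simp only: subsetD)
  qed
qed

end


section \<open>The generating algebra\<close>

fun bbar_join :: "bbar \<Rightarrow> bbar \<Rightarrow> bbar" where
  "bbar_join (Elem S) (Elem T) = Elem (S \<union> T)"
| "bbar_join _ _ = NewTop"

fun bbar_meet :: "bbar \<Rightarrow> bbar \<Rightarrow> bbar" where
  "bbar_meet (Elem S) (Elem T) = Elem (S \<inter> T)"
| "bbar_meet NewTop b = b"
| "bbar_meet a NewTop = a"

lemma Bbar_simps:
  "carrier (Bbar n) = insert NewTop (Elem ` Pow {1..n})" "eq (Bbar n) = (=)"
  "a \<sqsubseteq>\<^bsub>Bbar n\<^esub> b \<longleftrightarrow> bbar_le a b" "pcomp (Bbar n) = bbar_pcomp n"
  by (simp_all add: Bbar_def)

lemma finite_Bbar: "finite (carrier (Bbar n))"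
  by (simp add: Bbar_simps)

interpretation Bbar_ops: p_algebra_operations "Bbar n" bbar_join bbar_meet "Elem {}" NewTop
  by unfold_locales (auto simp: Bbar_simps split: if_splits)

interpretation Bbar: p_algebra "Bbar n"
  by (rule Bbar_ops.is_p_algebra)

text \<open>For an atom \<open>j\<close> of the Boolean part, the elements above \<open>j\<close> form a prime filter, and of an element
and its pseudocomplement exactly one lies in it. Sending this filter to the top and its complement to
the bottom is therefore compatible with all operations.\<close>

fun collapse :: "nat \<Rightarrow> bbar \<Rightarrow> bbar" where
  "collapse j (Elem S) = (if j \<in> S then NewTop else Elem {})"
| "collapse j NewTop = NewTop"

lemma collapse_p_hom: "j \<in> {1..n} \<Longrightarrow> collapse j \<in> p_hom (Bbar n) (Bbar n)"
  by (rule p_homI[OF Bbar.p_algebra_axioms Bbar.p_algebra_axioms])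
    (auto simp: Bbar_ops.operations Bbar_ops.bounds Bbar_simps split: if_splits)

lemma collapse_not_NewTop: "collapse j a \<noteq> NewTop \<longleftrightarrow> collapse j a = Elem {}"
  by (cases a) auto

text \<open>The prime filters of \<open>Bbar n\<close> are \<open>{NewTop}\<close> and the \<open>n\<close> principal filters of the atoms, and an
element is determined by the prime filters that contain it.\<close>

lemma Bbar_eqI:
  assumes "a \<in> carrier (Bbar n)" "b \<in> carrier (Bbar n)" "a = NewTop \<longleftrightarrow> b = NewTop"
    and "\<And>j. j \<in> {1..n} \<Longrightarrow> collapse j a = NewTop \<longleftrightarrow> collapse j b = NewTop"
  shows "a = b"
proof (cases a)
  case S: (Elem S)
  then obtain T where T: "b = Elem T" using assms(3) by (cases b) simp_all
  have "S \<subseteq> {1..n}" "T \<subseteq> {1..n}" using assms(1,2) S T by (auto simp: Bbar_simps)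
  moreover have "j \<in> S \<longleftrightarrow> j \<in> T" if "j \<in> {1..n}" for j
    using assms(4)[OF that] by (simp add: S T split: if_splits)
  ultimately have "S = T" by blast
  then show ?thesis by (simp add: S T)
qed (use assms(3) in simp)

lemma pcomp_eq_NewTop_iff:
  assumes "n \<ge> 1" "a \<in> carrier (Bbar n)"
  shows "bbar_pcomp n a = NewTop \<longleftrightarrow> (\<forall>j\<in>{1..n}. collapse j a \<noteq> NewTop)"
proof (cases a)
  case S: (Elem S)
  then have "S \<subseteq> {1..n}" using assms(2) by (auto simp: Bbar_simps)
  then have "S = {} \<longleftrightarrow> (\<forall>j\<in>{1..n}. j \<notin> S)" by blast
  then show ?thesis by (simp add: S)
qed (use assms(1) in auto)

text \<open>The filter \<open>{NewTop}\<close> is prime, which is the reason why its preimage under a homomorphism commutes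
with joins as well as with meets.\<close>

lemma p_hom_Bbar:
  assumes "p_algebra A" "h \<in> p_hom A (Bbar n)"
  shows hom_meet_NewTop: "\<lbrakk>a \<in> carrier A; b \<in> carrier A\<rbrakk> \<Longrightarrow>
      h (a \<sqinter>\<^bsub>A\<^esub> b) = NewTop \<longleftrightarrow> h a = NewTop \<and> h b = NewTop"
    and hom_join_NewTop: "\<lbrakk>a \<in> carrier A; b \<in> carrier A\<rbrakk> \<Longrightarrow>
      h (a \<squnion>\<^bsub>A\<^esub> b) = NewTop \<longleftrightarrow> h a = NewTop \<or> h b = NewTop"
    and hom_bottom_Bbar: "h \<bottom>\<^bsub>A\<^esub> = Elem {}" and hom_top_Bbar: "h \<top>\<^bsub>A\<^esub> = NewTop"
proof -
  show "h \<bottom>\<^bsub>A\<^esub> = Elem {}" "h \<top>\<^bsub>A\<^esub> = NewTop"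
    by (simp_all add: p_homD[OF assms(2)] Bbar_ops.bounds)
  assume ab: "a \<in> carrier A" "b \<in> carrier A"
  then have c: "h a \<in> carrier (Bbar n)" "h b \<in> carrier (Bbar n)"
    by (simp_all add: p_homD[OF assms(2)])
  show "h (a \<sqinter>\<^bsub>A\<^esub> b) = NewTop \<longleftrightarrow> h a = NewTop \<and> h b = NewTop"
    using ab c by (cases "h a"; cases "h b") (simp_all add: p_homD[OF assms(2)] Bbar_ops.operations)
  show "h (a \<squnion>\<^bsub>A\<^esub> b) = NewTop \<longleftrightarrow> h a = NewTop \<or> h b = NewTop"
    using ab c by (cases "h a"; cases "h b") (simp_all add: p_homD[OF assms(2)] Bbar_ops.operations)
qed

lemma hom_pcomp_NewTop:
  assumes "n \<ge> 1" "h \<in> p_hom A (Bbar n)" "a \<in> carrier A"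
  shows "h (pcomp A a) = NewTop \<longleftrightarrow> (\<forall>j\<in>{1..n}. collapse j (h a) \<noteq> NewTop)"
  using pcomp_eq_NewTop_iff[OF assms(1) p_hom_closed[OF assms(2,3)]]
  by (simp only: p_hom_pcomp[OF assms(2,3)] Bbar_simps(4))

lemma (in p_algebra) hom_inf_NewTop:
  assumes "h \<in> p_hom A (Bbar n)" "finite X" "X \<subseteq> carrier A"
  shows "h (\<Sqinter>X) = NewTop \<longleftrightarrow> (\<forall>a\<in>X. h a = NewTop)"
  using assms(2,3)
  by induction (simp_all add: inf_empty_top inf_insert_meet fin_inf_closed
      p_hom_Bbar[OF p_algebra_axioms assms(1)])

lemma (in p_algebra) hom_sup_NewTop:
  assumes "h \<in> p_hom A (Bbar n)" "finite X" "X \<subseteq> carrier A"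
  shows "h (\<Squnion>X) = NewTop \<longleftrightarrow> (\<exists>a\<in>X. h a = NewTop)"
  using assms(2,3)
  by induction (simp_all add: sup_empty_bottom sup_insert_join fin_sup_closed
      p_hom_Bbar[OF p_algebra_axioms assms(1)])


section \<open>Separation by homomorphisms into the generating algebra\<close>

locale free_p_algebra = p_algebra F for F :: "'a palgebra" (structure) +
  fixes n k :: nat and x :: "nat \<Rightarrow> 'a"
  assumes n_pos: "n \<ge> 1" and free: "free_in_Pa n k F x"
begin

abbreviation Hom :: "('a \<Rightarrow> bbar) set" where "Hom \<equiv> p_hom F (Bbar n)"

lemma gen_closed: "i \<in> {1..k} \<Longrightarrow> x i \<in> carrier F"
  using free unfolding free_in_Pa_def by blast

lemma generated: "carrier F = p_generate F (x ` {1..k})"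
  using free by (simp add: free_in_Pa_def)

lemma generated_induct [consumes 1, case_names generator bottom top meet join pcomp]:
  assumes "a \<in> carrier F" and "\<And>i. i \<in> {1..k} \<Longrightarrow> P (x i)" and "P \<bottom>" and "P \<top>"
    and "\<And>a b. \<lbrakk>a \<in> carrier F; b \<in> carrier F; P a; P b\<rbrakk> \<Longrightarrow> P (a \<sqinter> b)"
    and "\<And>a b. \<lbrakk>a \<in> carrier F; b \<in> carrier F; P a; P b\<rbrakk> \<Longrightarrow> P (a \<squnion> b)"
    and "\<And>a. \<lbrakk>a \<in> carrier F; P a\<rbrakk> \<Longrightarrow> P (pcomp F a)"
  shows "P a"
  using assms(1) unfolding generated
  by (induction rule: p_generate.induct) (use assms(2-) in \<open>unfold generated, blast\<close>)+

text \<open>The free extension goes first into the copy of \<open>Bbar n\<close> on the natural numbers and then back along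
the isomorphism.\<close>

lemma ex_hom_extending:
  assumes "\<And>i. i \<in> {1..k} \<Longrightarrow> v i \<in> carrier (Bbar n)"
  shows "\<exists>h\<in>Hom. \<forall>i\<in>{1..k}. h (x i) = v i"
proof -
  obtain f :: "bbar \<Rightarrow> nat" where inj: "inj_on f (carrier (Bbar n))"
    using finite_imp_inj_to_nat_seg[OF finite_Bbar] by blast
  define B where "B = copy f (Bbar n)"
  define g where "g = inv_into (carrier (Bbar n)) f"
  have B: "p_algebra B" "g \<in> p_hom B (Bbar n)"
    using copy_is_isomorphic[OF Bbar.p_algebra_axioms inj] by (simp_all add: B_def g_def)
  have carB: "carrier B = f ` carrier (Bbar n)" by (simp add: B_def copy_def Let_def)
  have "inj_on g (carrier B)" unfolding g_def carB by (rule inj_on_inv_into) simp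
  then have "in_Pa n B"
    using B by (auto simp: in_Pa_def in_equational_class_def intro: satisfies_if_injective_p_hom)
  moreover have "(f \<circ> v) ` {1..k} \<subseteq> carrier B" using assms by (auto simp: carB)
  ultimately obtain h where h: "h \<in> p_hom F B" "\<forall>i\<in>{1..k}. h (x i) = f (v i)"
    using free unfolding free_in_Pa_def by (metis comp_apply)
  have "g \<circ> h \<in> Hom"
    using p_hom_comp[OF p_algebra_axioms Bbar.p_algebra_axioms h(1) B(2)] .
  moreover have "(g \<circ> h) (x i) = v i" if "i \<in> {1..k}" for i
    using that h(2) assms inj by (simp add: g_def)
  ultimately show ?thesis by blast
qed

text \<open>The two elements are values of terms in \<open>x 1, \<dots>, x k\<close>. Every valuation of these variables in \<open>Bbar n\<close>
comes from some \<open>h\<close>, so the two terms form an identity of \<open>Bbar n\<close>, which \<open>F\<close> satisfies as well.\<close>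

lemma homs_separate:
  assumes ab: "a \<in> carrier F" "b \<in> carrier F" and eq: "\<And>h. h \<in> Hom \<Longrightarrow> h a = h b"
  shows "a = b"
proof -
  \<comment> \<open>Valuations are total, but \<open>x\<close> is only known to take values in \<open>F\<close> on \<open>{1..k}\<close>.\<close>
  define y where "y i = (if i \<in> {1..k} then x i else \<bottom>)" for i
  have y: "range y \<subseteq> carrier F" "y ` {1..k} = x ` {1..k}"
    using gen_closed by (auto simp: y_def)
  obtain s t where s: "pvars s \<subseteq> {1..k}" "a = peval F y s"
    and t: "pvars t \<subseteq> {1..k}" "b = peval F y t"
    using ab generated_by_term[of _ F y "{1..k}"] by (metis generated y(2))
  have "satisfies (Bbar n) (s, t)"
    unfolding satisfies_def
  proof (intro allI impI)
    fix v :: "nat \<Rightarrow> bbar" assume v: "range v \<subseteq> carrier (Bbar n)"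
    then obtain h where h: "h \<in> Hom" "\<forall>i\<in>{1..k}. h (x i) = v i"
      using ex_hom_extending[of v] by blast
    have "peval (Bbar n) v u = h (peval F y u)" if "pvars u \<subseteq> {1..k}" for u
      unfolding p_hom_peval[OF p_algebra_axioms h(1) y(1)]
      by (rule peval_cong) (use that h(2) in \<open>auto simp: y_def\<close>)
    then show "peval (Bbar n) v (fst (s, t)) = peval (Bbar n) v (snd (s, t))"
      using s t eq[OF h(1)] by simp
  qed
  then have "in_equational_class {(s, t)} (Bbar n)"
    using Bbar.p_algebra_axioms by (simp add: in_equational_class_def)
  then have "satisfies F (s, t)"
    using free by (auto simp: free_in_Pa_def in_Pa_def in_equational_class_def)
  then show ?thesis using y(1) s t by (simp add: satisfies_def)
qed

lemma collapse_hom: "\<lbrakk>h \<in> Hom; j \<in> {1..n}\<rbrakk> \<Longrightarrow> collapse j \<circ> h \<in> Hom"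
  by (rule p_hom_comp[OF p_algebra_axioms Bbar.p_algebra_axioms _ collapse_p_hom])

text \<open>To compare \<open>a\<close> with \<open>a \<sqinter> b\<close> under \<open>h\<close> one has to look at all prime filters of \<open>Bbar n\<close>; the one
of an atom \<open>j\<close> is the filter \<open>{NewTop}\<close> for the homomorphism \<open>collapse j \<circ> h\<close>.\<close>

lemma le_iff_homs:
  assumes ab: "a \<in> carrier F" "b \<in> carrier F"
  shows "a \<sqsubseteq> b \<longleftrightarrow> (\<forall>h\<in>Hom. h a = NewTop \<longrightarrow> h b = NewTop)"
proof
  assume "a \<sqsubseteq> b"
  then have "a = a \<sqinter> b" using ab le_iff_join by simp
  then show "\<forall>h\<in>Hom. h a = NewTop \<longrightarrow> h b = NewTop"
    using ab hom_meet_NewTop[OF p_algebra_axioms] by metis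
next
  assume le: "\<forall>h\<in>Hom. h a = NewTop \<longrightarrow> h b = NewTop"
  have "h a = h (a \<sqinter> b)" if h: "h \<in> Hom" for h
  proof (rule Bbar_eqI)
    show "h a \<in> carrier (Bbar n)" "h (a \<sqinter> b) \<in> carrier (Bbar n)"
      using ab p_hom_closed[OF h] by auto
    show "h a = NewTop \<longleftrightarrow> h (a \<sqinter> b) = NewTop"
      using le h ab by (auto simp: hom_meet_NewTop[OF p_algebra_axioms h])
    fix j assume "j \<in> {1..n}"
    then have "collapse j \<circ> h \<in> Hom" using h by (rule collapse_hom[rotated])
    then show "collapse j (h a) = NewTop \<longleftrightarrow> collapse j (h (a \<sqinter> b)) = NewTop"
      using le ab hom_meet_NewTop[OF p_algebra_axioms, of "collapse j \<circ> h"] by auto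
  qed
  then show "a \<sqsubseteq> b" using homs_separate[of a "a \<sqinter> b"] ab le_iff_join by auto
qed

lemma homs_eqI:
  assumes h: "h \<in> p_hom F B" "h' \<in> p_hom F B" and eq: "\<And>i. i \<in> {1..k} \<Longrightarrow> h (x i) = h' (x i)"
    and a: "a \<in> carrier F"
  shows "h a = h' a"
  using a by (induction rule: generated_induct) (simp_all only: p_homD[OF h(1)] p_homD[OF h(2)] eq)

section \<open>Worlds of homomorphisms and persistence\<close>

text \<open>The pair \<open>(points h, truth h)\<close> is the world of \<open>h\<close>: \<open>truth h\<close> lists the indices of the generators true at the filter
\<open>{NewTop}\<close>, and \<open>points h\<close> collects the same sets for the filters of the \<open>n\<close> atoms.\<close>

definition truth :: "('a \<Rightarrow> bbar) \<Rightarrow> nat set" where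
  "truth h = {i \<in> {1..k}. h (x i) = NewTop}"

definition points :: "('a \<Rightarrow> bbar) \<Rightarrow> nat set set" where
  "points h = (\<lambda>j. truth (collapse j \<circ> h)) ` {1..n}"

lemma world_bounds:
  shows "points h \<subseteq> Pow {1..k}" "0 < card (points h)" "card (points h) \<le> n"
    "truth h \<subseteq> \<Inter>(points h)" "truth h \<subseteq> {1..k}"
proof -
  show "points h \<subseteq> Pow {1..k}" "truth h \<subseteq> \<Inter>(points h)" "truth h \<subseteq> {1..k}"
    by (auto simp: points_def truth_def)
  show "card (points h) \<le> n" using card_image_le[of "{1..n}"] by (simp add: points_def)
  show "0 < card (points h)" using n_pos by (auto simp: points_def card_gt_0_iff)
qed

text \<open>By induction on the generation of \<open>a\<close>. The case that matters is the pseudocomplement: it is true if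
\<open>a\<close> is false at all atoms. The value of \<open>a\<close> at an atom depends only on the set of generators true
there, and each such set for \<open>h'\<close> also occurs for \<open>h\<close>. Hence falsity at all atoms for \<open>h\<close> implies
the same for \<open>h'\<close>.\<close>

lemma NewTop_persistent:
  assumes h: "h \<in> Hom" "h' \<in> Hom" and le: "points h' \<subseteq> points h" "truth h \<subseteq> truth h'"
    and a: "a \<in> carrier F" and "h a = NewTop"
  shows "h' a = NewTop"
proof -
  have "h a = NewTop \<longrightarrow> h' a = NewTop"
    using a
  proof (induction rule: generated_induct)
    case (generator i)
    then show ?case using le(2) by (auto simp: truth_def)
  next
    case (pcomp a)
    have "\<exists>j\<in>{1..n}. collapse j (h a) = collapse j' (h' a)" if j': "j' \<in> {1..n}" for j'
    proof -
      have "truth (collapse j' \<circ> h') \<in> points h" using le(1) j' by (auto simp: points_def)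
      then obtain j where j: "j \<in> {1..n}" "truth (collapse j' \<circ> h') = truth (collapse j \<circ> h)"
        unfolding points_def by blast
      have "(collapse j \<circ> h) a = (collapse j' \<circ> h') a"
      proof (rule homs_eqI[OF collapse_hom[OF h(1) j(1)] collapse_hom[OF h(2) j'] _ pcomp.hyps])
        fix i assume "i \<in> {1..k}"
        then have "collapse j (h (x i)) = NewTop \<longleftrightarrow> collapse j' (h' (x i)) = NewTop"
          using j(2) by (auto simp: truth_def)
        then show "(collapse j \<circ> h) (x i) = (collapse j' \<circ> h') (x i)"
          using collapse_not_NewTop by (metis comp_apply)
      qed
      then show ?thesis using j(1) by auto
    qed
    then show ?case unfolding hom_pcomp_NewTop[OF n_pos h(1) pcomp.hyps]
        hom_pcomp_NewTop[OF n_pos h(2) pcomp.hyps] by metis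
  qed (simp_all add: p_hom_Bbar[OF p_algebra_axioms h(1)] p_hom_Bbar[OF p_algebra_axioms h(2)])
  then show ?thesis using \<open>h a = NewTop\<close> by simp
qed

section \<open>The elements attached to worlds\<close>

lemma gen_image:
  assumes "L \<subseteq> {1..k}"
  shows "finite (x ` L)" "x ` L \<subseteq> carrier F"
    "finite ((\<lambda>i. pcomp F (x i)) ` L)" "(\<lambda>i. pcomp F (x i)) ` L \<subseteq> carrier F"
proof -
  have "finite L" using assms by (rule finite_subset) simp
  then show "finite (x ` L)" "finite ((\<lambda>i. pcomp F (x i)) ` L)" by simp_all
  show "x ` L \<subseteq> carrier F" "(\<lambda>i. pcomp F (x i)) ` L \<subseteq> carrier F"
    using assms gen_closed pcomp_closed by blast+
qed

lemma x_elem_closed: "T \<subseteq> {1..k} \<Longrightarrow> x_elem F k x T \<in> carrier F"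
  unfolding x_elem_def by (intro meet_closed fin_inf_closed gen_image) simp_all

lemma x_elem_image:
  assumes "\<T> \<subseteq> Pow {1..k}"
  shows "finite (x_elem F k x ` \<T>)" "x_elem F k x ` \<T> \<subseteq> carrier F"
proof -
  have "finite \<T>" using assms by (rule finite_subset) simp
  then show "finite (x_elem F k x ` \<T>)" by simp
  show "x_elem F k x ` \<T> \<subseteq> carrier F" using assms x_elem_closed by blast
qed

lemma p_elem_closed:
  assumes "\<T> \<subseteq> Pow {1..k}" "L \<subseteq> {1..k}"
  shows "p_elem F k x \<T> L \<in> carrier F"
  unfolding p_elem_def
  by (intro meet_closed pcomp_closed fin_sup_closed fin_inf_closed gen_image x_elem_image assms)

text \<open>At an atom the evaluation is two-valued, so \<open>x\<^sub>T\<close> is the minterm true exactly under the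
assignment \<open>T\<close>.\<close>

lemma collapse_hom_x_elem:
  assumes h: "h \<in> Hom" and j: "j \<in> {1..n}" and T: "T \<subseteq> {1..k}"
  shows "collapse j (h (x_elem F k x T)) = NewTop \<longleftrightarrow> truth (collapse j \<circ> h) = T"
proof -
  let ?g = "collapse j \<circ> h"
  have g: "?g \<in> Hom" by (rule collapse_hom[OF h j])
  have star: "?g (pcomp F (x i)) = NewTop \<longleftrightarrow> ?g (x i) \<noteq> NewTop" if "i \<in> {1..k}" for i
    using p_hom_pcomp[OF g gen_closed[OF that]] collapse_not_NewTop[of j "h (x i)"]
    by (auto simp: Bbar_simps)
  note pos = gen_image(1,2)[OF T] and neg = gen_image(3,4)[OF Diff_subset, of T]
  have "?g (x_elem F k x T) = NewTop \<longleftrightarrow>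
    (\<forall>i\<in>T. ?g (x i) = NewTop) \<and> (\<forall>i\<in>{1..k} - T. ?g (pcomp F (x i)) = NewTop)"
    unfolding x_elem_def
      hom_meet_NewTop[OF p_algebra_axioms g fin_inf_closed[OF pos] fin_inf_closed[OF neg]]
      hom_inf_NewTop[OF g pos] hom_inf_NewTop[OF g neg]
    by (simp only: ball_simps)
  also have "\<dots> \<longleftrightarrow> (\<forall>i\<in>T. ?g (x i) = NewTop) \<and> (\<forall>i\<in>{1..k} - T. ?g (x i) \<noteq> NewTop)"
    by (intro arg_cong2[of _ _ _ _ "(\<and>)"] ball_cong HOL.refl star) blast
  also have "\<dots> \<longleftrightarrow> truth ?g = T" unfolding truth_def using T by blast
  finally show ?thesis by (simp only: comp_apply)
qed

text \<open>A double pseudocomplement is the new top if and only if the original element is true at all atoms;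
for the join of the minterms \<open>x\<^sub>T\<close> this says that each atom realises an assignment in \<open>\<T>\<close>.\<close>

lemma hom_p_elem:
  assumes h: "h \<in> Hom" and \<T>: "\<T> \<subseteq> Pow {1..k}" and L: "L \<subseteq> {1..k}"
  shows "h (p_elem F k x \<T> L) = NewTop \<longleftrightarrow> points h \<subseteq> \<T> \<and> L \<subseteq> truth h"
proof -
  let ?X = "x_elem F k x ` \<T>"
  note X = x_elem_image[OF \<T>] and L' = gen_image(1,2)[OF L]
  have S: "\<Squnion>?X \<in> carrier F" by (rule fin_sup_closed[OF X])
  have collapse_pcomp: "collapse j (h (pcomp F a)) = NewTop \<longleftrightarrow> collapse j (h a) \<noteq> NewTop"
    if "a \<in> carrier F" "j \<in> {1..n}" for a j
    using p_hom_pcomp[OF collapse_hom[OF h that(2)] that(1)] collapse_not_NewTop[of j "h a"]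
    by (auto simp: Bbar_simps)
  have "h (pcomp F (pcomp F (\<Squnion>?X))) = NewTop \<longleftrightarrow>
      (\<forall>j\<in>{1..n}. collapse j (h (\<Squnion>?X)) = NewTop)"
    using collapse_pcomp[OF S] hom_pcomp_NewTop[OF n_pos h pcomp_closed[OF S]] by blast
  also have "\<dots> \<longleftrightarrow> (\<forall>j\<in>{1..n}. \<exists>T\<in>\<T>. collapse j (h (x_elem F k x T)) = NewTop)"
    using hom_sup_NewTop[OF collapse_hom[OF h] X]
    by (intro ball_cong HOL.refl) (simp only: comp_apply bex_simps)
  also have "\<dots> \<longleftrightarrow> (\<forall>j\<in>{1..n}. truth (collapse j \<circ> h) \<in> \<T>)"
  proof (rule ball_cong[OF HOL.refl])
    fix j assume "j \<in> {1..n}"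
    then have "collapse j (h (x_elem F k x T)) = NewTop \<longleftrightarrow> truth (collapse j \<circ> h) = T"
      if "T \<in> \<T>" for T using collapse_hom_x_elem[OF h, of j T] \<T> that by (metis PowD subsetD)
    then show "(\<exists>T\<in>\<T>. collapse j (h (x_elem F k x T)) = NewTop) \<longleftrightarrow>
        truth (collapse j \<circ> h) \<in> \<T>" by metis
  qed
  also have "\<dots> \<longleftrightarrow> points h \<subseteq> \<T>" by (simp only: points_def image_subset_iff)
  finally have support: "h (pcomp F (pcomp F (\<Squnion>?X))) = NewTop \<longleftrightarrow> points h \<subseteq> \<T>" .
  have "h (\<Sqinter>(x ` L)) = NewTop \<longleftrightarrow> L \<subseteq> truth h"
    unfolding hom_inf_NewTop[OF h L'] ball_simps truth_def using L by blast
  with support show ?thesis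
    unfolding p_elem_def using hom_meet_NewTop[OF p_algebra_axioms h
        pcomp_closed[OF pcomp_closed[OF S]] fin_inf_closed[OF L']] by metis
qed

abbreviation world_elem :: "('a \<Rightarrow> bbar) \<Rightarrow> 'a" where
  "world_elem h \<equiv> p_elem F k x (points h) (truth h)"

lemma world_elem_closed: "world_elem h \<in> carrier F"
  by (rule p_elem_closed[OF world_bounds(1,5)])

text \<open>The homomorphism \<open>h\<close> itself makes \<open>world_elem h\<close> true; every other homomorphism that does so has
fewer points and more truths than \<open>h\<close>, so persistence applies to it.\<close>

lemma world_elem_le_iff:
  assumes h: "h \<in> Hom" and t: "t \<in> carrier F"
  shows "world_elem h \<sqsubseteq> t \<longleftrightarrow> h t = NewTop"
proof -
  have "\<forall>g\<in>Hom. g (world_elem h) = NewTop \<longleftrightarrow> points g \<subseteq> points h \<and> truth h \<subseteq> truth g"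
    using hom_p_elem[OF _ world_bounds(1,5)] by metis
  then show ?thesis
    unfolding le_iff_homs[OF world_elem_closed t] using NewTop_persistent[OF h _ _ _ t] h
    by (metis order_refl)
qed

text \<open>By \<open>world_elem_le_iff\<close>, the elements above \<open>world_elem h\<close> are the preimage under \<open>h\<close> of the
prime filter \<open>{NewTop}\<close>, so \<open>world_elem h\<close> is even join-prime.\<close>

lemma world_elem_join_irreducible:
  assumes h: "h \<in> Hom"
  shows "world_elem h \<in> join_irreducibles F"
proof -
  have top: "h (world_elem h) = NewTop"
    by (rule iffD1[OF world_elem_le_iff[OF h world_elem_closed] le_refl[OF world_elem_closed]])
  have "world_elem h = a \<or> world_elem h = b"
    if ab: "a \<in> carrier F" "b \<in> carrier F" and eq: "world_elem h = a \<squnion> b" for a b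
  proof -
    have "h a = NewTop \<or> h b = NewTop"
      using top unfolding eq hom_join_NewTop[OF p_algebra_axioms h ab] .
    then have "world_elem h \<sqsubseteq> a \<or> world_elem h \<sqsubseteq> b" using ab world_elem_le_iff[OF h] by metis
    moreover have "a \<sqsubseteq> world_elem h" "b \<sqsubseteq> world_elem h"
      unfolding eq by (rule join_left[OF ab] join_right[OF ab])+
    ultimately show ?thesis
      using le_antisym[OF _ _ world_elem_closed ab(1)] le_antisym[OF _ _ world_elem_closed ab(2)]
      by iprover
  qed
  moreover have "world_elem h \<noteq> \<bottom>" using top hom_bottom_Bbar[OF p_algebra_axioms h] by force
  ultimately show ?thesis by (simp add: join_irreducibles_def world_elem_closed)
qed

text \<open>This is what makes the joins in question exist: only finitely many pairs \<open>(\<T>, L)\<close> come into play.\<close>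

lemma irred_p_elems_below_finite: "finite (irred_p_elems_below n k F x t)"
proof (rule finite_subset)
  show "irred_p_elems_below n k F x t \<subseteq>
      (\<lambda>(\<T>, L). p_elem F k x \<T> L) ` (Pow (Pow {1..k}) \<times> Pow {1..k})"
  proof
    fix a assume "a \<in> irred_p_elems_below n k F x t"
    then obtain \<T> L where a: "a = p_elem F k x \<T> L" and TL: "\<T> \<subseteq> Pow {1..k}" "0 < card \<T>" "L \<subseteq> \<Inter>\<T>"
      unfolding irred_p_elems_below_def by blast
    (* A member of \<T> bounds L; over the empty \<T> the intersection would be everything. *)
    from TL(2) obtain T where "T \<in> \<T>" by (metis card.empty less_irrefl all_not_in_conv)
    with TL have "(\<T>, L) \<in> Pow (Pow {1..k}) \<times> Pow {1..k}" by blast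
    then show "a \<in> (\<lambda>(\<T>, L). p_elem F k x \<T> L) ` (Pow (Pow {1..k}) \<times> Pow {1..k})"
      by (rule rev_image_eqI) (simp add: a)
  qed
qed simp

lemma irred_p_elems_below_closed: "irred_p_elems_below n k F x t \<subseteq> carrier F"
  unfolding irred_p_elems_below_def join_irreducibles_def by blast

lemma eq_sup_irred_p_elems:
  assumes t: "t \<in> carrier F"
  shows "t = \<Squnion>(irred_p_elems_below n k F x t)"
proof (rule le_antisym)
  let ?P = "irred_p_elems_below n k F x t"
  note P = irred_p_elems_below_finite[of t] irred_p_elems_below_closed[of t]
  show "t \<in> carrier F" "\<Squnion>?P \<in> carrier F" by (rule t fin_sup_closed[OF P])+
  show "\<Squnion>?P \<sqsubseteq> t"
    by (rule fin_sup_le[OF P t]) (unfold irred_p_elems_below_def, blast)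
  have "h (\<Squnion>?P) = NewTop" if h: "h \<in> Hom" "h t = NewTop" for h
  proof -
    have "world_elem h \<in> ?P"
      unfolding irred_p_elems_below_def
      using world_bounds[of h] world_elem_join_irreducible[OF h(1)] world_elem_le_iff[OF h(1) t] h(2)
      by blast
    then show ?thesis
      using world_elem_le_iff[OF h(1) fin_sup_closed[OF P]] fin_sup_upper[OF P] by metis
  qed
  then show "t \<sqsubseteq> \<Squnion>?P" using le_iff_homs[OF t fin_sup_closed[OF P]] by blast
qed

end

theorem theorem5p8:
  fixes n k :: nat and F :: "'a palgebra" and x :: "nat \<Rightarrow> 'a" and t :: 'a
  assumes "n \<ge> 1"
    and "free_in_Pa n k F x"
    and "t \<in> carrier F"
  shows "t = \<Squnion>\<^bsub>F\<^esub>(irred_p_elems_below n k F x t) \<and>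
    t = \<Squnion>\<^bsub>F\<^esub>(max_elems F (irred_p_elems_below n k F x t))"
proof -
  have "in_equational_class {} (Bbar n)"
    using Bbar.p_algebra_axioms by (simp add: in_equational_class_def)
  then have "p_algebra F"
    using assms(2) by (auto simp: free_in_Pa_def in_Pa_def in_equational_class_def)
  then interpret free_p_algebra F n k x
    using assms by (simp add: free_p_algebra_def free_p_algebra_axioms_def)
  show ?thesis
    unfolding sup_max_elems[OF irred_p_elems_below_finite irred_p_elems_below_closed]
    by (intro conjI eq_sup_irred_p_elems[OF assms(3)])
qed

end
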